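(* Let $\triangle ABC$ be a (non-degenerate) triangle and let $\mathcal{Y}$ be the conic through the six vertices of its V-ellipses $\mathcal{E}_a,\mathcal{E}_b,\mathcal{E}_c$. Then $\mathcal{Y}$ is degenerate if and only if $\triangle ABC$ is a right triangle.
   Context: Given a triangle $\triangle ABC$, the V-ellipse $\mathcal{E}_a$ is the ellipse with foci $B,C$ passing through $A$; $\mathcal{E}_b$ is the ellipse with foci $C,A$ passing through $B$; $\mathcal{E}_c$ is the ellipse with foci $A,B$ passing through $C$. The vertices of an ellipse are its two intersections with its focal axis (the line through the foci). The six vertices of the three V-ellipses always lie on a conic $\mathcal{Y}$ (the Yiu conic). A conic is degenerate if the $3\times 3$ symmetric matrix of its homogeneous equation is singular (e.g. it is a pair of lines). *)

theory Defs
  imports "HOL-Analysis.Analysis"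
begin

definition ellipse_through :: "real^2 \<Rightarrow> real^2 \<Rightarrow> real^2 \<Rightarrow> (real^2) set" where
  "ellipse_through F G P = {X. dist X F + dist X G = dist P F + dist P G}"

definition ellipse_vertices :: "real^2 \<Rightarrow> real^2 \<Rightarrow> real^2 \<Rightarrow> (real^2) set" where
  "ellipse_vertices F G P = ellipse_through F G P \<inter> affine hull {F, G}"

definition V_ellipse_vertices :: "real^2 \<Rightarrow> real^2 \<Rightarrow> real^2 \<Rightarrow> (real^2) set" where
  "V_ellipse_vertices A B C =
     ellipse_vertices B C A \<union> ellipse_vertices C A B \<union> ellipse_vertices A B C"

text \<open>
  A conic is represented by the nonzero symmetric matrix of its homogeneous equation
  \<open>h \<bullet> (M *v h) = 0\<close>; proportional matrices represent the same conic. A point of the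
  plane has homogeneous coordinates \<open>(x, y, 1)\<close>.
\<close>

definition hom_coords :: "real^2 \<Rightarrow> real^3" where
  "hom_coords X = vector [X $ 1, X $ 2, 1]"

definition is_conic :: "real^3^3 \<Rightarrow> bool" where
  "is_conic M \<longleftrightarrow> transpose M = M \<and> M \<noteq> 0"

definition conic_points :: "real^3^3 \<Rightarrow> (real^2) set" where
  "conic_points M = {X. hom_coords X \<bullet> (M *v hom_coords X) = 0}"

definition degenerate_conic :: "real^3^3 \<Rightarrow> bool" where
  "degenerate_conic M \<longleftrightarrow> det M = 0"

definition is_Yiu_conic :: "real^2 \<Rightarrow> real^2 \<Rightarrow> real^2 \<Rightarrow> real^3^3 \<Rightarrow> bool" where
  "is_Yiu_conic A B C M \<longleftrightarrow> is_conic M \<and> V_ellipse_vertices A B C \<subseteq> conic_points M"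

definition right_triangle :: "real^2 \<Rightarrow> real^2 \<Rightarrow> real^2 \<Rightarrow> bool" where
  "right_triangle A B C \<longleftrightarrow>
     orthogonal (B - A) (C - A) \<or> orthogonal (C - B) (A - B) \<or> orthogonal (A - C) (B - C)"

text \<open>
  The remaining facts show that a Yiu conic exists for every non-degenerate triangle. With
  \<open>a, b, c\<close> the side lengths, its equation in barycentric coordinates \<open>(x, y, z)\<close> is
  \<open>x\<^sup>2 + y\<^sup>2 + z\<^sup>2 + 2 p y z + 2 q x z + 2 r x y = 0\<close> where
  \<open>p = ((b + c)\<^sup>2 + a\<^sup>2) / ((b + c)\<^sup>2 - a\<^sup>2)\<close>, and cyclically for \<open>q\<close> and \<open>r\<close>.
\<close>

definition Yiu_coeff :: "real \<Rightarrow> real \<Rightarrow> real" where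
  "Yiu_coeff s a = (s\<^sup>2 + a\<^sup>2) / (s\<^sup>2 - a\<^sup>2)"

lemma vertex_param_eq:
  fixes t a s :: real
  assumes a: "0 < a" "a < s" and t: "(\<bar>t\<bar> + \<bar>1 - t\<bar>) * a = s"
  shows "(1 - t)\<^sup>2 + t\<^sup>2 + 2 * Yiu_coeff s a * (t * (1 - t)) = 0"
proof -
  have "\<not> (0 \<le> t \<and> t \<le> 1)" using a t by auto
  then have s: "s\<^sup>2 = ((2 * t - 1) * a)\<^sup>2"
    using t by (auto simp: not_le power2_eq_square algebra_simps)
  have nz: "s\<^sup>2 - a\<^sup>2 \<noteq> 0"
    using a power_strict_mono[of a s 2] by auto
  have "((1 - t)\<^sup>2 + t\<^sup>2) * (s\<^sup>2 - a\<^sup>2) + 2 * (s\<^sup>2 + a\<^sup>2) * (t * (1 - t)) = 0"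
    unfolding s by algebra
  with nz show ?thesis unfolding Yiu_coeff_def by (simp add: field_simps)
qed

lemma ellipse_vertex_param:
  fixes A B C X :: "real^2"
  assumes nc: "\<not> collinear {A, B, C}" and X: "X \<in> ellipse_vertices B C A"
  obtains t where "X = (1 - t) *\<^sub>R B + t *\<^sub>R C"
    "(1 - t)\<^sup>2 + t\<^sup>2 + 2 * Yiu_coeff (dist A B + dist A C) (dist B C) * (t * (1 - t)) = 0"
proof -
  obtain u t where ut: "u + t = 1" "X = u *\<^sub>R B + t *\<^sub>R C"
    using X unfolding ellipse_vertices_def affine_hull_2 by auto
  have u: "u = 1 - t" using ut by simp
  have XB: "X - B = t *\<^sub>R (C - B)" and XC: "X - C = (1 - t) *\<^sub>R (B - C)"
    unfolding ut u by (simp_all add: algebra_simps)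
  have "dist X B + dist X C = dist A B + dist A C"
    using X unfolding ellipse_vertices_def ellipse_through_def by auto
  then have eq: "(\<bar>t\<bar> + \<bar>1 - t\<bar>) * dist B C = dist A B + dist A C"
    unfolding dist_norm XB XC norm_scaleR norm_minus_commute[of C B] by (simp only: distrib_right)
  have pos: "0 < dist B C" using nc by auto
  have "\<not> between (B, C) A"
    using nc between_imp_collinear[of B C A] by (auto simp: insert_commute)
  then have "dist B C < dist A B + dist A C"
    using dist_triangle[of B C A] unfolding between by (simp add: dist_commute)
  from vertex_param_eq[OF pos this eq] show ?thesis using that ut u by blast
qed

definition side_form :: "real^2 \<Rightarrow> real^2 \<Rightarrow> real^3" where
  "side_form P Q = vector [P $ 2 - Q $ 2, Q $ 1 - P $ 1, P $ 1 * Q $ 2 - P $ 2 * Q $ 1]"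

definition Yiu_matrix :: "real^2 \<Rightarrow> real^2 \<Rightarrow> real^2 \<Rightarrow> real^3^3" where
  "Yiu_matrix A B C =
     (let L = vector [side_form B C, side_form C A, side_form A B] :: real^3^3;
          p = Yiu_coeff (dist A B + dist A C) (dist B C);
          q = Yiu_coeff (dist B C + dist B A) (dist C A);
          r = Yiu_coeff (dist C A + dist C B) (dist A B);
          G = vector [vector [1, r, q], vector [r, 1, p], vector [q, p, 1]] :: real^3^3
      in transpose L ** G ** L)"

lemma Yiu_matrix_form:
  fixes A B C X :: "real^2"
  defines "x \<equiv> side_form B C \<bullet> hom_coords X"
    and "y \<equiv> side_form C A \<bullet> hom_coords X"
    and "z \<equiv> side_form A B \<bullet> hom_coords X"
  shows "hom_coords X \<bullet> (Yiu_matrix A B C *v hom_coords X) =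
    x\<^sup>2 + y\<^sup>2 + z\<^sup>2
    + 2 * Yiu_coeff (dist A B + dist A C) (dist B C) * (y * z)
    + 2 * Yiu_coeff (dist B C + dist B A) (dist C A) * (x * z)
    + 2 * Yiu_coeff (dist C A + dist C B) (dist A B) * (x * y)"
proof -
  define L :: "real^3^3" where "L = vector [side_form B C, side_form C A, side_form A B]"
  have L: "L *v hom_coords X = vector [x, y, z]"
    unfolding L_def x_def y_def z_def
    by (simp add: vec_eq_iff forall_3 matrix_vector_mult_def inner_vec_def sum_3)
  have quad: "v \<bullet> ((transpose L ** G ** L) *v v) = (L *v v) \<bullet> (G *v (L *v v))" for v and G :: "real^3^3"
    by (metis dot_lmul_matrix matrix_vector_mul_assoc vector_transpose_matrix)
  show ?thesis
    unfolding Yiu_matrix_def Let_def L_def[symmetric] quad L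
    by (simp add: inner_vec_def sum_3 matrix_vector_mult_def power2_eq_square
        dist_commute algebra_simps)
qed

lemma side_form_nonzero:
  fixes A B C :: "real^2"
  assumes "\<not> collinear {A, B, C}"
  shows "side_form B C \<bullet> hom_coords A \<noteq> 0"
proof
  assume "side_form B C \<bullet> hom_coords A = 0"
  then have d: "(B $ 2 - C $ 2) * (A $ 1 - C $ 1) = (B $ 1 - C $ 1) * (A $ 2 - C $ 2)"
    by (simp add: side_form_def hom_coords_def inner_vec_def sum_3 algebra_simps)
  have BC: "B \<noteq> C" using assms by auto
  then have "B $ 1 - C $ 1 \<noteq> 0 \<or> B $ 2 - C $ 2 \<noteq> 0" by (auto simp: vec_eq_iff forall_2)
  then obtain u where "A - C = u *\<^sub>R (B - C)"
  proof
    assume "B $ 1 - C $ 1 \<noteq> 0"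
    moreover from this have "(A $ 1 - C $ 1) / (B $ 1 - C $ 1) * (B $ 2 - C $ 2) = A $ 2 - C $ 2"
      using d by (simp add: divide_eq_eq mult.commute)
    ultimately have "A - C = ((A $ 1 - C $ 1) / (B $ 1 - C $ 1)) *\<^sub>R (B - C)"
      by (simp add: vec_eq_iff forall_2)
    then show ?thesis using that by blast
  next
    assume "B $ 2 - C $ 2 \<noteq> 0"
    moreover from this have "(A $ 2 - C $ 2) / (B $ 2 - C $ 2) * (B $ 1 - C $ 1) = A $ 1 - C $ 1"
      using d by (simp add: divide_eq_eq mult.commute)
    ultimately have "A - C = ((A $ 2 - C $ 2) / (B $ 2 - C $ 2)) *\<^sub>R (B - C)"
      by (simp add: vec_eq_iff forall_2)
    then show ?thesis using that by blast
  qed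
  then have "A = u *\<^sub>R B + (1 - u) *\<^sub>R C" by (simp add: algebra_simps)
  then have "collinear {B, A, C}" unfolding collinear_3_expand by blast
  with assms show False by (simp add: insert_commute)
qed

lemma side_form_combination:
  "side_form P Q \<bullet> hom_coords ((1 - t) *\<^sub>R U + t *\<^sub>R V) =
     (1 - t) * (side_form P Q \<bullet> hom_coords U) + t * (side_form P Q \<bullet> hom_coords V)"
  by (simp add: side_form_def hom_coords_def inner_vec_def sum_3 algebra_simps)

lemma side_form_vertex: "side_form P Q \<bullet> hom_coords P = 0" "side_form P Q \<bullet> hom_coords Q = 0"
  by (simp_all add: side_form_def hom_coords_def inner_vec_def sum_3 algebra_simps)

lemma side_form_cycle: "side_form P Q \<bullet> hom_coords R = side_form Q R \<bullet> hom_coords P"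
  by (simp add: side_form_def hom_coords_def inner_vec_def sum_3 algebra_simps)

lemma Yiu_matrix_cycle: "hom_coords X \<bullet> (Yiu_matrix B C A *v hom_coords X) =
    hom_coords X \<bullet> (Yiu_matrix A B C *v hom_coords X)"
  unfolding Yiu_matrix_form by simp

lemma Yiu_matrix_vertices:
  fixes A B C :: "real^2"
  assumes nc: "\<not> collinear {A, B, C}"
  shows "ellipse_vertices B C A \<subseteq> conic_points (Yiu_matrix A B C)"
proof
  fix X assume "X \<in> ellipse_vertices B C A"
  then obtain t where X: "X = (1 - t) *\<^sub>R B + t *\<^sub>R C"
    and t: "(1 - t)\<^sup>2 + t\<^sup>2 + 2 * Yiu_coeff (dist A B + dist A C) (dist B C) * (t * (1 - t)) = 0"
    using ellipse_vertex_param[OF nc] by blast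
  define d where "d = side_form B C \<bullet> hom_coords A"
  have x: "side_form B C \<bullet> hom_coords X = 0"
    unfolding X side_form_combination by (simp add: side_form_vertex)
  have y: "side_form C A \<bullet> hom_coords X = (1 - t) * d"
    unfolding X side_form_combination d_def
    by (simp add: side_form_vertex side_form_cycle[of B C A])
  have z: "side_form A B \<bullet> hom_coords X = t * d"
    unfolding X side_form_combination d_def
    by (simp add: side_form_vertex side_form_cycle[of A B C])
  have "hom_coords X \<bullet> (Yiu_matrix A B C *v hom_coords X) =
    d\<^sup>2 * ((1 - t)\<^sup>2 + t\<^sup>2 + 2 * Yiu_coeff (dist A B + dist A C) (dist B C) * (t * (1 - t)))"
    unfolding Yiu_matrix_form x y z by (simp add: power2_eq_square algebra_simps)
  then show "X \<in> conic_points (Yiu_matrix A B C)"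
    unfolding conic_points_def t by simp
qed

lemma Yiu_conic_exists:
  fixes A B C :: "real^2"
  assumes nc: "\<not> collinear {A, B, C}"
  shows "is_Yiu_conic A B C (Yiu_matrix A B C)"
proof -
  have nc': "\<not> collinear {B, C, A}" "\<not> collinear {C, A, B}"
    using nc by (simp_all add: insert_commute)
  have pts: "conic_points (Yiu_matrix B C A) = conic_points (Yiu_matrix A B C)"
    "conic_points (Yiu_matrix C A B) = conic_points (Yiu_matrix A B C)"
    unfolding conic_points_def using Yiu_matrix_cycle by metis+
  have sub: "V_ellipse_vertices A B C \<subseteq> conic_points (Yiu_matrix A B C)"
    using Yiu_matrix_vertices[OF nc] Yiu_matrix_vertices[OF nc'(1)]
      Yiu_matrix_vertices[OF nc'(2)]
    unfolding V_ellipse_vertices_def pts by blast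
  have G: "transpose (vector [vector [1, r, q], vector [r, 1, p], vector [q, p, 1]]) =
      (vector [vector [1, r, q], vector [r, 1, p], vector [q, p, 1]] :: real^3^3)" for p q r :: real
    by (simp add: vec_eq_iff forall_3 transpose_def)
  have sym: "transpose (Yiu_matrix A B C) = Yiu_matrix A B C"
    unfolding Yiu_matrix_def Let_def
    by (simp add: matrix_transpose_mul G matrix_mul_assoc)
  have "hom_coords A \<bullet> (Yiu_matrix A B C *v hom_coords A) = (side_form B C \<bullet> hom_coords A)\<^sup>2"
    unfolding Yiu_matrix_form by (simp add: side_form_vertex)
  with side_form_nonzero[OF nc] have "Yiu_matrix A B C \<noteq> 0" by auto
  with sub sym show ?thesis unfolding is_Yiu_conic_def is_conic_def by blast
qed

end

theory Submission
  imports Defs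
begin

text \<open>
  Write the quadratic form of the conic in barycentric coordinates. The two vertices on a side
  are exchanged by the half-turn about its midpoint, so vanishing at both forces equal
  coefficients at the two squares and determines the mixed coefficient; the form is thus a nonzero
  multiple of \<open>x\<^sup>2 + y\<^sup>2 + z\<^sup>2 + 2 p y z + 2 q x z + 2 r x y\<close>. The determinant
  \<open>1 + 2 p q r - p\<^sup>2 - q\<^sup>2 - r\<^sup>2\<close> is, up to a positive factor, the product of the
  three expressions \<open>b\<^sup>2 + c\<^sup>2 - a\<^sup>2\<close>.
\<close>

text \<open>Both \<open>X - B\<close> and \<open>X - C\<close> are multiples of the side vector, so
  the focal distances of a point on line \<open>BC\<close> are linear in the absolute values of its
  parameters. This supplies explicit vertices at which a conic can be evaluated.\<close>

lemma ellipse_vertexI: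
  fixes A B C :: "real^2"
  assumes "\<bar>t\<bar> * dist B C + \<bar>1 - t\<bar> * dist B C = dist A B + dist A C"
  shows "(1 - t) *\<^sub>R B + t *\<^sub>R C \<in> ellipse_vertices B C A"
proof -
  let ?X = "(1 - t) *\<^sub>R B + t *\<^sub>R C"
  have XB: "?X - B = t *\<^sub>R (C - B)" and XC: "?X - C = (1 - t) *\<^sub>R (B - C)"
    by (simp_all add: algebra_simps)
  have "dist ?X B + dist ?X C = dist A B + dist A C"
    using assms unfolding dist_norm XB XC norm_scaleR norm_minus_commute[of C B] by simp
  moreover have "?X \<in> affine hull {B, C}"
    unfolding affine_hull_2 by (rule CollectI, rule exI[of _ "1 - t"], rule exI[of _ t]) simp
  ultimately show ?thesis
    unfolding ellipse_vertices_def ellipse_through_def by simp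
qed

lemma noncollinear_strict_triangle:
  fixes A B C :: "'a::euclidean_space"
  assumes "\<not> collinear {A, B, C}"
  shows "dist B C < dist A B + dist A C"
proof -
  have "\<not> between (B, C) A"
    using assms between_imp_collinear[of B C A] by (auto simp: insert_commute)
  then show ?thesis
    using dist_triangle[of B C A] unfolding between by (simp add: dist_commute)
qed

lemma symmetric_matrix_inner:
  fixes M :: "real^'n^'n"
  assumes "transpose M = M"
  shows "u \<bullet> (M *v v) = v \<bullet> (M *v u)"
  by (metis assms dot_lmul_matrix inner_commute vector_transpose_matrix)

lemma hom_coords_combination:
  "hom_coords ((1 - t) *\<^sub>R U + t *\<^sub>R V) = (1 - t) *\<^sub>R hom_coords U + t *\<^sub>R hom_coords V"
  by (simp add: hom_coords_def vec_eq_iff forall_3 algebra_simps)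

text \<open>On line \<open>UV\<close> the conic restricts to a binary quadratic form in
  \<open>(1 - t, t)\<close>; symmetry of \<open>M\<close> merges the two cross terms into
  one.\<close>

lemma conic_points_combination:
  assumes sym: "transpose M = M"
  shows "(1 - t) *\<^sub>R U + t *\<^sub>R V \<in> conic_points M \<longleftrightarrow>
    (1 - t)\<^sup>2 * (hom_coords U \<bullet> (M *v hom_coords U)) + t\<^sup>2 * (hom_coords V \<bullet> (M *v hom_coords V))
      + 2 * t * (1 - t) * (hom_coords U \<bullet> (M *v hom_coords V)) = 0"
proof -
  have "(s *\<^sub>R u + t *\<^sub>R v) \<bullet> (M *v (s *\<^sub>R u + t *\<^sub>R v)) =
      s\<^sup>2 * (u \<bullet> (M *v u)) + t\<^sup>2 * (v \<bullet> (M *v v)) + 2 * t * s * (u \<bullet> (M *v v))" for s t u v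
    using symmetric_matrix_inner[OF sym, of v u]
    by (simp add: matrix_vector_right_distrib matrix_vector_mult_scaleR inner_add_left
        inner_add_right power2_eq_square algebra_simps)
  then show ?thesis
    unfolding conic_points_def mem_Collect_eq hom_coords_combination by simp
qed

text \<open>The two vertices on line \<open>BC\<close> give two linear equations in the three
  coefficients of the form restricted to that line, which fixes them up to scale. The other sides
  follow by cyclic renaming.\<close>

lemma conic_side_coefficients:
  fixes A B C :: "real^2"
  assumes nc: "\<not> collinear {A, B, C}" and sym: "transpose M = M"
    and sub: "ellipse_vertices B C A \<subseteq> conic_points M"
  shows "hom_coords B \<bullet> (M *v hom_coords B) = hom_coords C \<bullet> (M *v hom_coords C)" (is "?\<beta> = ?\<gamma>")
    and "hom_coords B \<bullet> (M *v hom_coords C) =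
      Yiu_coeff (dist A B + dist A C) (dist B C) * (hom_coords B \<bullet> (M *v hom_coords B))"
      (is "?f = _ * _")
proof -
  define a where "a = dist B C"
  define s where "s = dist A B + dist A C"
  \<comment> \<open>The ratio of major axis to focal distance, that is, the reciprocal of the
    eccentricity.\<close>
  define k where "k = s / a"
  have a: "0 < a" "a < s"
    using nc noncollinear_strict_triangle[OF nc] by (auto simp: a_def s_def)
  then have k: "1 < k" and ka: "k * a = s" by (simp_all add: k_def)
  have vertex: "(1 - t)\<^sup>2 * ?\<beta> + t\<^sup>2 * ?\<gamma> + 2 * t * (1 - t) * ?f = 0"
    if "\<bar>t\<bar> + \<bar>1 - t\<bar> = k" for t
  proof -
    have "\<bar>t\<bar> * a + \<bar>1 - t\<bar> * a = s"
      using that ka by (simp flip: distrib_right)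
    then have "(1 - t) *\<^sub>R B + t *\<^sub>R C \<in> conic_points M"
      using ellipse_vertexI sub unfolding a_def s_def by blast
    then show ?thesis unfolding conic_points_combination[OF sym] .
  qed
  \<comment> \<open>Outside [0, 1] the sum of the absolute values of \<open>t\<close> and
    \<open>1 - t\<close> is that of \<open>2 * t - 1\<close>, so the vertices sit at
    \<open>t = (1 + k) / 2\<close> and \<open>t = (1 - k) / 2\<close>. Both equations are scaled by
    4.\<close>
  have 1: "(1 - k)\<^sup>2 * ?\<beta> + (1 + k)\<^sup>2 * ?\<gamma> + 2 * (1 + k) * (1 - k) * ?f = 0"
    using vertex[of "(1 + k) / 2"] k by (simp add: field_simps power2_eq_square)
  have 2: "(1 + k)\<^sup>2 * ?\<beta> + (1 - k)\<^sup>2 * ?\<gamma> + 2 * (1 - k) * (1 + k) * ?f = 0"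
    using vertex[of "(1 - k) / 2"] k by (simp add: field_simps power2_eq_square)
  \<comment> \<open>Subtracting the equations cancels the mixed term.\<close>
  have "4 * k * (?\<beta> - ?\<gamma>) = 0" using 1 2 by algebra
  then show eq: "?\<beta> = ?\<gamma>" using k by simp
  have "(k\<^sup>2 - 1) * ?f = (k\<^sup>2 + 1) * ?\<beta>"
    using 1 eq by algebra
  then have "(s\<^sup>2 - a\<^sup>2) * ?f = (s\<^sup>2 + a\<^sup>2) * ?\<beta>"
    unfolding ka[symmetric] by algebra
  moreover have "s\<^sup>2 - a\<^sup>2 \<noteq> 0"
    using a power_strict_mono[of a s 2] by auto
  ultimately show "?f = Yiu_coeff (dist A B + dist A C) (dist B C) * ?\<beta>"
    unfolding Yiu_coeff_def a_def[symmetric] s_def[symmetric] by (simp add: field_simps)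
qed

text \<open>With \<open>P\<close> the matrix of rows \<open>u, v, w\<close>, the product
  \<open>P ** M ** transpose P\<close> is their Gram matrix under the form \<open>M\<close>; its
  determinant has a factor \<open>m\<close> in each row. If \<open>m = 0\<close> the whole Gram
  matrix vanishes, and invertibility of \<open>P\<close> then forces \<open>M = 0\<close>.\<close>

lemma det_gram_3:
  fixes M :: "real^3^3" and u v w :: "real^3"
  assumes sym: "transpose M = M"
    and diag: "u \<bullet> (M *v u) = m" "v \<bullet> (M *v v) = m" "w \<bullet> (M *v w) = m"
    and mixed: "v \<bullet> (M *v w) = p * m" "w \<bullet> (M *v u) = q * m" "u \<bullet> (M *v v) = r * m"
  shows "(det (vector [u, v, w] :: real^3^3))\<^sup>2 * det M = m ^ 3 * (1 + 2 * p * q * r - p\<^sup>2 - q\<^sup>2 - r\<^sup>2)"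
    and "det (vector [u, v, w] :: real^3^3) \<noteq> 0 \<Longrightarrow> M \<noteq> 0 \<Longrightarrow> m \<noteq> 0"
proof -
  define P :: "real^3^3" where "P = vector [u, v, w]"
  define G :: "real^3^3" where
    "G = vector [vector [m, r * m, q * m], vector [r * m, m, p * m], vector [q * m, p * m, m]]"
  have entry: "(P ** M ** transpose P) $ i $ j = (P $ i) \<bullet> (M *v (P $ j))" for i j
    by (simp add: matrix_matrix_mult_def matrix_vector_mult_def inner_vec_def transpose_def sum_3
        algebra_simps)
  have mixed': "w \<bullet> (M *v v) = p * m" "u \<bullet> (M *v w) = q * m" "v \<bullet> (M *v u) = r * m"
    using mixed symmetric_matrix_inner[OF sym] by metis+
  have G: "P ** M ** transpose P = G"
    unfolding vec_eq_iff forall_3 entry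
    by (simp add: P_def G_def diag mixed mixed')
  have "(det P)\<^sup>2 * det M = det G"
    unfolding G[symmetric] by (simp add: det_mul power2_eq_square)
  also have "\<dots> = m ^ 3 * (1 + 2 * p * q * r - p\<^sup>2 - q\<^sup>2 - r\<^sup>2)"
    unfolding det_3 G_def by (simp add: power2_eq_square power3_eq_cube algebra_simps)
  finally show "(det (vector [u, v, w] :: real^3^3))\<^sup>2 * det M =
      m ^ 3 * (1 + 2 * p * q * r - p\<^sup>2 - q\<^sup>2 - r\<^sup>2)"
    unfolding P_def .
  show "m \<noteq> 0" if "det (vector [u, v, w] :: real^3^3) \<noteq> 0" "M \<noteq> 0"
  proof
    assume "m = 0"
    then have zero: "P ** M ** transpose P = 0"
      unfolding G by (simp add: G_def vec_eq_iff forall_3)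
    have "invertible P"
      using that(1) unfolding P_def[symmetric] by (simp add: invertible_det_nz)
    then obtain Q where Q: "Q ** P = mat 1"
      unfolding invertible_def by blast
    have "transpose P ** transpose Q = mat 1"
      unfolding matrix_transpose_mul[symmetric] Q by simp
    then have "M = (Q ** P) ** M ** (transpose P ** transpose Q)"
      unfolding Q by simp
    also have "\<dots> = Q ** (P ** M ** transpose P) ** transpose Q"
      by (simp only: matrix_mul_assoc)
    also have "\<dots> = 0"
      unfolding zero by (simp add: matrix_matrix_mult_def vec_eq_iff)
    finally have "M = 0" .
    with that(2) show False ..
  qed
qed

text \<open>Both sides are twice the signed area of the triangle; the right one is the cofactor
  expansion along the first row.\<close>

lemma det_hom_coords:
  "det (vector [hom_coords A, hom_coords B, hom_coords C] :: real^3^3) = side_form B C \<bullet> hom_coords A"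
  by (simp add: det_3 side_form_def hom_coords_def inner_vec_def sum_3 algebra_simps)

lemma Yiu_determinant:
  fixes a b c :: real
  assumes "0 < a" "0 < b" "0 < c" "a < b + c" "b < c + a" "c < a + b"
  defines "p \<equiv> Yiu_coeff (b + c) a" and "q \<equiv> Yiu_coeff (c + a) b" and "r \<equiv> Yiu_coeff (a + b) c"
  shows "1 + 2 * p * q * r - p\<^sup>2 - q\<^sup>2 - r\<^sup>2 = 0 \<longleftrightarrow>
    b\<^sup>2 + c\<^sup>2 = a\<^sup>2 \<or> c\<^sup>2 + a\<^sup>2 = b\<^sup>2 \<or> a\<^sup>2 + b\<^sup>2 = c\<^sup>2"
proof -
  \<comment> \<open>The denominators of \<open>p\<close>, \<open>q\<close>, \<open>r\<close> factor
    as \<open>S * x\<close>, \<open>S * y\<close>, \<open>S * z\<close>, all positive.\<close>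
  define S x y z where "S = a + b + c" and "x = b + c - a" and "y = c + a - b" and "z = a + b - c"
  have pos: "0 < S" "0 < x" "0 < y" "0 < z"
    using assms by (simp_all add: S_def x_def y_def z_def)
  have pqr: "S * x * p = (b + c)\<^sup>2 + a\<^sup>2" "S * y * q = (c + a)\<^sup>2 + b\<^sup>2" "S * z * r = (a + b)\<^sup>2 + c\<^sup>2"
  proof -
    have *: "(t + s) * (s - t) * Yiu_coeff s t = s\<^sup>2 + t\<^sup>2" if "0 < t" "t < s" for s t :: real
    proof -
      have "(t + s) * (s - t) = s\<^sup>2 - t\<^sup>2"
        by (simp add: power2_eq_square algebra_simps)
      moreover have "(t + s) * (s - t) \<noteq> 0" using that by simp
      ultimately show ?thesis unfolding Yiu_coeff_def by simp
    qed
    show "S * x * p = (b + c)\<^sup>2 + a\<^sup>2" "S * y * q = (c + a)\<^sup>2 + b\<^sup>2" "S * z * r = (a + b)\<^sup>2 + c\<^sup>2"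
      using *[of a "b + c"] *[of b "c + a"] *[of c "a + b"] assms
      by (simp_all add: S_def x_def y_def z_def p_def q_def r_def add_ac)
  qed
  \<comment> \<open>\<open>K\<close> is the cubic cofactor left when the cleared determinant is
    divided by \<open>E\<close>; its terms are visibly positive.\<close>
  define K where "K = 4 * (S * (a\<^sup>2 + b\<^sup>2 + c\<^sup>2) + 4 * a * b * c)"
  define D where "D = 1 + 2 * p * q * r - p\<^sup>2 - q\<^sup>2 - r\<^sup>2"
  define E where "E = (b\<^sup>2 + c\<^sup>2 - a\<^sup>2) * (c\<^sup>2 + a\<^sup>2 - b\<^sup>2) * (a\<^sup>2 + b\<^sup>2 - c\<^sup>2)"
  \<comment> \<open>The multiplier clears \<open>p * q * r\<close> and all three squares at once;
    regrouping leaves \<open>p\<close>, \<open>q\<close>, \<open>r\<close> only inside the products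
    that \<open>pqr\<close> evaluates.\<close>
  have "S ^ 3 * (x * y * z)\<^sup>2 * D = S ^ 3 * (x * y * z)\<^sup>2
      + 2 * (x * y * z) * ((S * x * p) * (S * y * q) * (S * z * r))
      - S * ((y * z)\<^sup>2 * (S * x * p)\<^sup>2 + (z * x)\<^sup>2 * (S * y * q)\<^sup>2 + (x * y)\<^sup>2 * (S * z * r)\<^sup>2)"
    unfolding D_def by algebra
  also have "\<dots> = K * E"
    unfolding pqr unfolding K_def E_def S_def x_def y_def z_def
    by (simp add: power2_eq_square power3_eq_cube algebra_simps)
  finally have "S ^ 3 * (x * y * z)\<^sup>2 * D = K * E" .
  moreover have "K > 0"
    unfolding K_def using assms(1-3) pos by (simp add: add_pos_pos)
  moreover have "S ^ 3 * (x * y * z)\<^sup>2 > 0" using pos by simp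
  ultimately have "D = 0 \<longleftrightarrow> E = 0"
    by (metis less_irrefl mult_eq_0_iff)
  then show ?thesis unfolding D_def E_def by auto
qed

lemma orthogonal_iff_Pythagorean:
  fixes A B C :: "'a::real_inner"
  shows "orthogonal (B - A) (C - A) \<longleftrightarrow> (dist C A)\<^sup>2 + (dist A B)\<^sup>2 = (dist B C)\<^sup>2"
  unfolding orthogonal_def dot_norm_neg
  by (simp add: dist_norm norm_minus_commute add.commute)

theorem proposition5:
  fixes A B C :: "real^2" and Y :: "real^3^3"
  assumes "\<not> collinear {A, B, C}"
    and "is_Yiu_conic A B C Y"
  shows "degenerate_conic Y \<longleftrightarrow> right_triangle A B C"
proof -
  have nc: "\<not> collinear {A, B, C}" "\<not> collinear {B, C, A}" "\<not> collinear {C, A, B}"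
    using assms(1) by (simp_all add: insert_commute)
  define a b c where "a = dist B C" and "b = dist C A" and "c = dist A B"
  define p q r where "p = Yiu_coeff (b + c) a" and "q = Yiu_coeff (c + a) b"
    and "r = Yiu_coeff (a + b) c"
  have Y: "transpose Y = Y" "Y \<noteq> 0" and sub: "ellipse_vertices B C A \<subseteq> conic_points Y"
    "ellipse_vertices C A B \<subseteq> conic_points Y" "ellipse_vertices A B C \<subseteq> conic_points Y"
    using assms(2) unfolding is_Yiu_conic_def is_conic_def V_ellipse_vertices_def by auto
  note side = conic_side_coefficients[OF nc(1) Y(1) sub(1)]
    conic_side_coefficients[OF nc(2) Y(1) sub(2)] conic_side_coefficients[OF nc(3) Y(1) sub(3)]
  define m where "m = hom_coords A \<bullet> (Y *v hom_coords A)"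
  have diag: "hom_coords A \<bullet> (Y *v hom_coords A) = m" "hom_coords B \<bullet> (Y *v hom_coords B) = m"
    "hom_coords C \<bullet> (Y *v hom_coords C) = m"
    using side(1,3,5) by (simp_all add: m_def)
  have mixed: "hom_coords B \<bullet> (Y *v hom_coords C) = p * m"
    "hom_coords C \<bullet> (Y *v hom_coords A) = q * m" "hom_coords A \<bullet> (Y *v hom_coords B) = r * m"
    using side(2,4,6)
    by (simp_all add: diag p_def q_def r_def a_def b_def c_def dist_commute add.commute)
  let ?d = "det (vector [hom_coords A, hom_coords B, hom_coords C] :: real^3^3)"
  have d: "?d \<noteq> 0"
    unfolding det_hom_coords by (rule side_form_nonzero[OF nc(1)])
  \<comment> \<open>The vertices are independent in homogeneous coordinates, so \<open>?d\<close>
    and, since \<open>Y\<close> is nonzero, also \<open>m\<close> can be cancelled.\<close>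
  have "det Y = 0 \<longleftrightarrow> 1 + 2 * p * q * r - p\<^sup>2 - q\<^sup>2 - r\<^sup>2 = 0"
    using det_gram_3(1)[OF Y(1) diag mixed] det_gram_3(2)[OF Y(1) diag mixed d Y(2)] d
    by (metis mult_eq_0_iff power_eq_0_iff)
  also have "\<dots> \<longleftrightarrow> b\<^sup>2 + c\<^sup>2 = a\<^sup>2 \<or> c\<^sup>2 + a\<^sup>2 = b\<^sup>2 \<or> a\<^sup>2 + b\<^sup>2 = c\<^sup>2"
    unfolding p_def q_def r_def
  proof (rule Yiu_determinant)
    show "0 < a" "0 < b" "0 < c"
      using nc by (auto simp: a_def b_def c_def)
    show "a < b + c" "b < c + a" "c < a + b"
      using nc[THEN noncollinear_strict_triangle]
      by (simp_all add: a_def b_def c_def dist_commute add.commute)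
  qed
  also have "\<dots> \<longleftrightarrow> right_triangle A B C"
    unfolding right_triangle_def orthogonal_iff_Pythagorean a_def b_def c_def ..
  finally show ?thesis unfolding degenerate_conic_def .
qed

end
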